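(* Let $f$ be a holomorphic function on $\mathbb{D}=\{z\in\mathbb{C}:|z|<1\}$ with $|f|\le 1$ which is not a conformal automorphism of $\mathbb{D}$, and suppose $f(0)=0$. Then, for $z\in\mathbb{D}\setminus\{0\}$, $$\left|\frac12z^2f''(z)-\frac{zf'(z)-f(z)}{1-|z|^2}+\frac{\overline{f(z)}(zf'(z)-f(z))^2}{|z|^2-|f(z)|^2}\right|+\frac{|z||zf'(z)-f(z)|^2}{|z|^2-|f(z)|^2}\le\frac{|z|(|z|^2-|f(z)|^2)}{(1-|z|^2)^2}.$$ *)

theory Defs
  imports "HOL-Complex_Analysis.Complex_Analysis"
begin

definition conformal_automorphism :: "(complex \<Rightarrow> complex) \<Rightarrow> complex set \<Rightarrow> bool" where
  "conformal_automorphism f S \<longleftrightarrow>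
     f holomorphic_on S \<and> bij_betw f S S \<and> inv_into S f holomorphic_on S"

end

theory Submission
  imports Defs
begin

text \<open>
  Since \<open>f 0 = 0\<close>, we may write \<open>f w = w * g w\<close> with \<open>g\<close> holomorphic, and by the Schwarz lemma
  \<open>g\<close> maps the disc into the closed disc. If \<open>g\<close> touched the unit circle it would be a unimodular
  constant and \<open>f\<close> a rotation, hence an automorphism; so \<open>g\<close> maps the disc into itself. Substituting
  \<open>f w = w * g w\<close> and dividing by \<open>norm z ^ 3\<close>, the claimed inequality becomes the second-order
  Schwarz--Pick inequality
  \<open>norm (g'' / 2 - cnj z * g' / (1 - \<bar>z\<bar>\<^sup>2) + cnj g * g'\<^sup>2 / (1 - \<bar>g\<bar>\<^sup>2)) + \<bar>g'\<bar>\<^sup>2 / (1 - \<bar>g\<bar>\<^sup>2)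
   \<le> (1 - \<bar>g\<bar>\<^sup>2) / (1 - \<bar>z\<bar>\<^sup>2)\<^sup>2\<close> for \<open>g\<close> at the point \<open>z\<close>.

  That inequality is the first-order Schwarz--Pick inequality for another function, the hyperbolic
  difference quotient \<open>G w = [g w, g z] / [w, z]\<close>, where \<open>[a, b] = (a - b) / (1 - cnj b * a)\<close>.
  The Schwarz lemma, transported by Moebius maps, says that \<open>G\<close> is holomorphic and bounded by 1
  (\<open>hyperbolic_difference_quotient\<close>). Differentiating the identity that defines \<open>G\<close> once and twice
  at \<open>z\<close> expresses \<open>G z\<close> and \<open>G' z\<close> through \<open>g'\<close> and \<open>g''\<close>
  (\<open>hyperbolic_difference_quotient_derivs\<close>), and
  \<open>\<bar>G' z\<bar> * (1 - \<bar>z\<bar>\<^sup>2) \<le> 1 - \<bar>G z\<bar>\<^sup>2\<close> is then exactly what is needed.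
\<close>

text \<open>The strong maximum principle: a modulus of 1 at an interior point would be a maximum.\<close>

lemma bounded_by_1_strict_or_constant:
  assumes "f holomorphic_on ball 0 1" and "\<And>w. w \<in> ball 0 1 \<Longrightarrow> norm (f w) \<le> 1"
  shows "(\<forall>w\<in>ball 0 1. norm (f w) < 1) \<or> (\<exists>c. norm c = 1 \<and> (\<forall>w\<in>ball 0 1. f w = c))"
proof (rule disjCI)
  assume "\<not> (\<exists>c. norm c = 1 \<and> (\<forall>w\<in>ball 0 1. f w = c))"
  then have no: "\<And>c. norm c = 1 \<Longrightarrow> \<exists>w\<in>ball 0 1. f w \<noteq> c"
    by blast
  show "\<forall>w\<in>ball 0 1. norm (f w) < 1"
  proof (rule ccontr)
    assume "\<not> (\<forall>w\<in>ball 0 1. norm (f w) < 1)"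
    then obtain w where w: "w \<in> ball 0 1" "norm (f w) = 1"
      using assms(2) by force
    have "f constant_on ball 0 1"
      by (rule maximum_modulus_principle[OF assms(1), of "ball 0 1" w]) (use w assms(2) in auto)
    then show False
      using no[OF w(2)] w(1) unfolding constant_on_def by metis
  qed
qed

text \<open>
  The value at 0 excludes a unimodular constant, so \<open>f\<close> is strictly bounded by 1 and
  the Schwarz lemma applies. At \<open>w = 0\<close> its derivative part gives the bound, as \<open>h 0 = f' 0\<close>.
\<close>

lemma Schwarz_quotient:
  assumes "f holomorphic_on ball 0 1" and "\<And>w. w \<in> ball 0 1 \<Longrightarrow> norm (f w) \<le> 1" and "f 0 = 0"
  obtains h where "h holomorphic_on ball 0 1"
    and "\<And>w. w \<in> ball 0 1 \<Longrightarrow> f w = w * h w"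
    and "\<And>w. w \<in> ball 0 1 \<Longrightarrow> norm (h w) \<le> 1"
proof -
  obtain h where h: "h holomorphic_on ball 0 1" "\<And>w. norm w < 1 \<Longrightarrow> f w = w * h w"
      "deriv f 0 = h 0"
    using Schwarz3[OF assms(1,3)] by metis
  have less: "norm (f w) < 1" if "norm w < 1" for w
    using bounded_by_1_strict_or_constant[OF assms(1,2)] assms(3) that by fastforce
  have "norm (h w) \<le> 1" if w: "norm w < 1" for w
  proof (cases "w = 0")
    case True
    then show ?thesis
      using Schwarz_Lemma(2)[OF assms(1,3) less w] h(3) by simp
  next
    case False
    then show ?thesis
      using Schwarz_Lemma(1)[OF assms(1,3) less w] h(2)[OF w] by (simp add: norm_mult)
  qed
  then show thesis
    using h that by simp
qed

lemma one_minus_cnj_mult_nonzero: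
  fixes a b :: complex
  assumes "norm a < 1" "norm b < 1"
  shows "1 - cnj a * b \<noteq> 0"
proof
  assume "1 - cnj a * b = 0"
  then have "norm (cnj a * b) = 1"
    by simp
  moreover have "norm a * norm b < 1"
    using assms by (metis norm_mult norm_mult_less mult_1)
  ultimately show False
    by (simp add: norm_mult)
qed

text \<open>
  Moving \<open>z\<close> and \<open>g z\<close> to the origin by Moebius maps turns \<open>g\<close> into a self-map of the disc that
  fixes 0; \<open>G\<close> is its Schwarz quotient, moved back. The identity is stated without divisions so that
  it can be differentiated at \<open>w = z\<close>.
\<close>

lemma hyperbolic_difference_quotient:
  assumes "g holomorphic_on ball 0 1" and g1: "\<And>w. w \<in> ball 0 1 \<Longrightarrow> norm (g w) < 1"
    and z: "z \<in> ball 0 1"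
  obtains G where "G holomorphic_on ball 0 1"
    and "\<And>w. w \<in> ball 0 1 \<Longrightarrow> norm (G w) \<le> 1"
    and "\<And>w. w \<in> ball 0 1 \<Longrightarrow>
           (g w - g z) * (1 - cnj z * w) = G w * ((w - z) * (1 - cnj (g z) * g w))"
proof -
  define M where "M = Moebius_function 0"
  have Mhol: "M a holomorphic_on ball 0 1" if "norm a < 1" for a
    unfolding M_def using that by (rule Moebius_function_holomorphic)
  have M1: "norm (M a w) < 1" if "norm a < 1" "norm w < 1" for a w
    unfolding M_def using that by (rule Moebius_function_norm_lt_1)
  have z1: "norm z < 1" "norm (- z) < 1" and gz: "norm (g z) < 1"
    using z g1 by auto
  define H where "H = M (g z) \<circ> (g \<circ> M (- z))"
  have "H holomorphic_on ball 0 1"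
    unfolding H_def
    by (intro holomorphic_on_compose_gen[where t = "ball 0 1"] Mhol assms(1) z1 gz)
       (use M1 z1 g1 in auto)
  moreover have "norm (H w) \<le> 1" if "w \<in> ball 0 1" for w
    unfolding H_def using M1[OF gz g1] M1[OF z1(2)] that by (simp add: less_imp_le)
  moreover have "H 0 = 0"
    by (simp add: H_def M_def Moebius_function_def)
  ultimately obtain h where h: "h holomorphic_on ball 0 1"
      "\<And>w. w \<in> ball 0 1 \<Longrightarrow> H w = w * h w" "\<And>w. w \<in> ball 0 1 \<Longrightarrow> norm (h w) \<le> 1"
    using Schwarz_quotient[of H] by blast
  show thesis
  proof
    show "(h \<circ> M z) holomorphic_on ball 0 1"
      by (intro holomorphic_on_compose_gen[where t = "ball 0 1"] Mhol h(1) z1)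
         (use M1 z1 in auto)
    show "norm ((h \<circ> M z) w) \<le> 1" if "w \<in> ball 0 1" for w
      using h(3) M1[OF z1(1)] that by simp
    fix w :: complex
    assume w: "w \<in> ball 0 1"
    have "M (- z) (M z w) = w"
      unfolding M_def by (rule Moebius_function_compose) (use z1 w in auto)
    then have "M (g z) (g w) = M z w * (h \<circ> M z) w"
      using h(2)[of "M z w"] M1[OF z1(1)] w by (simp add: H_def)
    moreover have "1 - cnj z * w \<noteq> 0" "1 - cnj (g z) * g w \<noteq> 0"
      using one_minus_cnj_mult_nonzero z1(1) w gz g1 by auto
    ultimately show "(g w - g z) * (1 - cnj z * w)
        = (h \<circ> M z) w * ((w - z) * (1 - cnj (g z) * g w))"
      by (simp add: M_def Moebius_function_simple divide_simps)
  qed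
qed

lemma complex_one_minus_cnj_self: "1 - cnj a * a = of_real (1 - (norm a)\<^sup>2)"
  by (simp add: complex_norm_square mult.commute del: of_real_power)

text \<open>
  These formulas come from differentiating the defining identity of the quotient at \<open>w = z\<close>. The
  factor \<open>w - z\<close> on the right makes the order drop by one: two derivatives of \<open>g\<close> determine
  one derivative of \<open>G\<close>.
\<close>

lemma hyperbolic_difference_quotient_derivs:
  assumes holg: "g holomorphic_on S" and holG: "G holomorphic_on S" and S: "open S" and z: "z \<in> S"
    and eq: "\<And>w. w \<in> S \<Longrightarrow>
           (g w - g z) * (1 - cnj z * w) = G w * ((w - z) * (1 - cnj (g z) * g w))"
  shows "deriv g z * of_real (1 - (norm z)\<^sup>2) = G z * of_real (1 - (norm (g z))\<^sup>2)"
    and "deriv (deriv g) z * of_real (1 - (norm z)\<^sup>2) - 2 * cnj z * deriv g z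
         = 2 * deriv G z * of_real (1 - (norm (g z))\<^sup>2) - 2 * G z * cnj (g z) * deriv g z"
proof -
  have d: "(g has_field_derivative deriv g w) (at w)" "(G has_field_derivative deriv G w) (at w)"
    "(deriv g has_field_derivative deriv (deriv g) w) (at w)"
    "(deriv G has_field_derivative deriv (deriv G) w) (at w)" if "w \<in> S" for w
    using holg holG holomorphic_deriv[OF _ S] S that by (auto intro!: holomorphic_derivI)
  have d1: "deriv g w * (1 - cnj z * w) - cnj z * (g w - g z)
      = deriv G w * ((w - z) * (1 - cnj (g z) * g w))
        + G w * ((1 - cnj (g z) * g w) - (w - z) * cnj (g z) * deriv g w)" if w: "w \<in> S" for w
  proof (rule DERIV_unique)
    show "((\<lambda>w. (g w - g z) * (1 - cnj z * w)) has_field_derivative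
        deriv g w * (1 - cnj z * w) - cnj z * (g w - g z)) (at w)"
      by (auto intro!: derivative_eq_intros d[OF w] simp: algebra_simps)
    have "((\<lambda>w. G w * ((w - z) * (1 - cnj (g z) * g w))) has_field_derivative
        deriv G w * ((w - z) * (1 - cnj (g z) * g w))
        + G w * ((1 - cnj (g z) * g w) - (w - z) * cnj (g z) * deriv g w)) (at w)"
      by (auto intro!: derivative_eq_intros d[OF w] simp: algebra_simps)
    then show "((\<lambda>w. (g w - g z) * (1 - cnj z * w)) has_field_derivative
        deriv G w * ((w - z) * (1 - cnj (g z) * g w))
        + G w * ((1 - cnj (g z) * g w) - (w - z) * cnj (g z) * deriv g w)) (at w)"
      by (rule has_field_derivative_transform_within_open[OF _ S w]) (simp add: eq)
  qed
  show "deriv g z * of_real (1 - (norm z)\<^sup>2) = G z * of_real (1 - (norm (g z))\<^sup>2)"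
    using d1[OF z] by (simp del: of_real_diff flip: complex_one_minus_cnj_self)
  have "deriv (deriv g) z * (1 - cnj z * z) - 2 * cnj z * deriv g z
      = 2 * deriv G z * (1 - cnj (g z) * g z) - 2 * G z * cnj (g z) * deriv g z"
  proof (rule DERIV_unique)
    show "((\<lambda>w. deriv g w * (1 - cnj z * w) - cnj z * (g w - g z)) has_field_derivative
        deriv (deriv g) z * (1 - cnj z * z) - 2 * cnj z * deriv g z) (at z)"
      by (auto intro!: derivative_eq_intros d[OF z] simp: algebra_simps)
    have "((\<lambda>w. deriv G w * ((w - z) * (1 - cnj (g z) * g w))
          + G w * ((1 - cnj (g z) * g w) - (w - z) * cnj (g z) * deriv g w)) has_field_derivative
        2 * deriv G z * (1 - cnj (g z) * g z) - 2 * G z * cnj (g z) * deriv g z) (at z)"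
      by (auto intro!: derivative_eq_intros d[OF z] simp: algebra_simps)
    then show "((\<lambda>w. deriv g w * (1 - cnj z * w) - cnj z * (g w - g z)) has_field_derivative
        2 * deriv G z * (1 - cnj (g z) * g z) - 2 * G z * cnj (g z) * deriv g z) (at z)"
      by (rule has_field_derivative_transform_within_open[OF _ S z]) (simp add: d1)
  qed
  then show "deriv (deriv g) z * of_real (1 - (norm z)\<^sup>2) - 2 * cnj z * deriv g z
         = 2 * deriv G z * of_real (1 - (norm (g z))\<^sup>2) - 2 * G z * cnj (g z) * deriv g z"
    by (simp only: complex_one_minus_cnj_self)
qed

text \<open>
  The bound \<open>norm (G z) \<le> 1\<close> on the difference quotient, read at \<open>z\<close>. Unimodular constants
  are included, because the quotient \<open>G\<close> of a self-map of the disc can be one.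
\<close>

lemma Schwarz_Pick_deriv:
  assumes "g holomorphic_on ball 0 1" and "\<And>w. w \<in> ball 0 1 \<Longrightarrow> norm (g w) \<le> 1"
    and z: "z \<in> ball 0 1"
  shows "norm (deriv g z) * (1 - (norm z)\<^sup>2) \<le> 1 - (norm (g z))\<^sup>2"
proof -
  consider "\<forall>w\<in>ball 0 1. norm (g w) < 1" | c where "norm c = 1" "\<forall>w\<in>ball 0 1. g w = c"
    using bounded_by_1_strict_or_constant[OF assms(1,2)] by blast
  then show ?thesis
  proof cases
    case 1
    note less = 1
    obtain G where G: "G holomorphic_on ball 0 1" "\<And>w. w \<in> ball 0 1 \<Longrightarrow> norm (G w) \<le> 1"
        "\<And>w. w \<in> ball 0 1 \<Longrightarrow>
             (g w - g z) * (1 - cnj z * w) = G w * ((w - z) * (1 - cnj (g z) * g w))"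
      by (rule hyperbolic_difference_quotient[OF assms(1) _ z]) (use less in auto)
    have "(norm z)\<^sup>2 < 1" "(norm (g z))\<^sup>2 < 1"
      using z less by (auto simp: power_less_one_iff)
    moreover have "norm (deriv g z * of_real (1 - (norm z)\<^sup>2))
        = norm (G z * of_real (1 - (norm (g z))\<^sup>2))"
      using hyperbolic_difference_quotient_derivs(1)[OF assms(1) G(1) _ z G(3)] by simp
    ultimately have "norm (deriv g z) * (1 - (norm z)\<^sup>2) = norm (G z) * (1 - (norm (g z))\<^sup>2)"
      by (simp only: norm_mult norm_of_real abs_of_pos diff_gt_0_iff_gt)
    also have "\<dots> \<le> 1 * (1 - (norm (g z))\<^sup>2)"
      using G(2)[OF z] \<open>(norm (g z))\<^sup>2 < 1\<close> by (intro mult_right_mono) auto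
    finally show ?thesis
      by simp
  next
    case (2 c)
    note c = 2
    have "(g has_field_derivative 0) (at z)"
      by (rule has_field_derivative_transform_within_open[OF DERIV_const[of c] open_ball z])
         (use c in simp)
    then show ?thesis
      using c z by (simp add: DERIV_imp_deriv)
  qed
qed

text \<open>
  Schwarz--Pick for \<open>G\<close> at \<open>z\<close>: up to the positive factor \<open>R\<^sup>2 / A\<close>, with
  \<open>R = 1 - (norm z)\<^sup>2\<close> and \<open>A = 1 - (norm (g z))\<^sup>2\<close>, the first summand is
  \<open>norm (G' z) * R\<close>, the second is \<open>(norm (G z))\<^sup>2\<close> and the right-hand side is 1.
\<close>

lemma second_order_Schwarz_Pick:
  assumes "g holomorphic_on ball 0 1" and g1: "\<And>w. w \<in> ball 0 1 \<Longrightarrow> norm (g w) < 1"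
    and z: "z \<in> ball 0 1"
  shows "norm (deriv (deriv g) z / 2 - cnj z * deriv g z / of_real (1 - (norm z)\<^sup>2)
               + cnj (g z) * (deriv g z)\<^sup>2 / of_real (1 - (norm (g z))\<^sup>2))
         + (norm (deriv g z))\<^sup>2 / (1 - (norm (g z))\<^sup>2)
         \<le> (1 - (norm (g z))\<^sup>2) / (1 - (norm z)\<^sup>2)\<^sup>2"
proof -
  obtain G where G: "G holomorphic_on ball 0 1" "\<And>w. w \<in> ball 0 1 \<Longrightarrow> norm (G w) \<le> 1"
      "\<And>w. w \<in> ball 0 1 \<Longrightarrow>
           (g w - g z) * (1 - cnj z * w) = G w * ((w - z) * (1 - cnj (g z) * g w))"
    by (rule hyperbolic_difference_quotient[OF assms]) auto
  define R A where "R = 1 - (norm z)\<^sup>2" and "A = 1 - (norm (g z))\<^sup>2"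
  have pos: "R > 0" "A > 0"
    unfolding R_def A_def using z g1 by (auto simp: power_less_one_iff)
  have "deriv g z * R = G z * A"
    "deriv (deriv g) z * R - 2 * cnj z * deriv g z
       = 2 * deriv G z * A - 2 * G z * cnj (g z) * deriv g z"
    using hyperbolic_difference_quotient_derivs[OF assms(1) G(1) _ z G(3)]
    unfolding R_def A_def by simp_all
  moreover have nz: "complex_of_real R \<noteq> 0" "complex_of_real A \<noteq> 0"
    using pos by auto
  ultimately have G0: "G z = deriv g z * R / A"
    and G1: "2 * deriv G z * A
       = deriv (deriv g) z * R - 2 * cnj z * deriv g z + 2 * G z * cnj (g z) * deriv g z"
    by (auto simp: field_simps)
  have "deriv (deriv g) z / 2 - cnj z * deriv g z / R + cnj (g z) * (deriv g z)\<^sup>2 / A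
      = (2 * deriv G z * A) / (2 * R)"
    unfolding G1 G0 using nz by (simp add: field_simps power2_eq_square)
  then have "norm (deriv (deriv g) z / 2 - cnj z * deriv g z / R + cnj (g z) * (deriv g z)\<^sup>2 / A)
      = norm (deriv G z) * A / R"
    using pos by (simp add: norm_mult norm_divide)
  also have "\<dots> = (norm (deriv G z) * R) * (A / R\<^sup>2)"
    using pos by (simp add: field_simps power2_eq_square)
  also have "\<dots> \<le> (1 - (norm (G z))\<^sup>2) * (A / R\<^sup>2)"
    using Schwarz_Pick_deriv[OF G(1,2) z] pos unfolding R_def[symmetric]
    by (intro mult_right_mono) auto
  also have "norm (G z) = norm (deriv g z) * R / A"
    using pos by (simp add: G0 norm_mult norm_divide)
  also have "(1 - (norm (deriv g z) * R / A)\<^sup>2) * (A / R\<^sup>2) = A / R\<^sup>2 - (norm (deriv g z))\<^sup>2 / A"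
    using pos by (simp add: field_simps power2_eq_square)
  finally show ?thesis
    unfolding R_def A_def by simp
qed

lemma rotation_conformal_automorphism:
  assumes c: "norm c = 1" and f: "\<And>w. w \<in> ball 0 1 \<Longrightarrow> f w = c * w"
  shows "conformal_automorphism f (ball 0 1)"
proof -
  have c0: "c \<noteq> 0"
    using c by auto
  have bij: "bij_betw f (ball 0 1) (ball 0 1)"
    by (rule bij_betwI[where g = "\<lambda>w. w / c"])
       (use c c0 f in \<open>auto simp: norm_mult norm_divide\<close>)
  have "inv_into (ball 0 1) f w = w / c" if "w \<in> ball 0 1" for w
    by (rule inv_into_f_eq)
       (use bij that c c0 f in \<open>auto simp: bij_betw_def norm_divide\<close>)
  moreover have "(\<lambda>w. w / c) holomorphic_on ball 0 1" "(\<lambda>w. c * w) holomorphic_on ball 0 1"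
    using c0 by (auto intro!: holomorphic_intros)
  ultimately show ?thesis
    unfolding conformal_automorphism_def using bij f by (metis (no_types, lifting) holomorphic_cong)
qed

theorem theorem3p7:
  fixes f :: "complex \<Rightarrow> complex" and z :: complex
  assumes "f holomorphic_on ball 0 1"
    and "\<And>w. w \<in> ball 0 1 \<Longrightarrow> norm (f w) \<le> 1"
    and "\<not> conformal_automorphism f (ball 0 1)"
    and "f 0 = 0"
    and "z \<in> ball 0 1 - {0}"
  shows "norm (1 / 2 * z\<^sup>2 * (deriv ^^ 2) f z
            - (z * deriv f z - f z) / of_real (1 - (norm z)\<^sup>2)
            + cnj (f z) * (z * deriv f z - f z)\<^sup>2 / of_real ((norm z)\<^sup>2 - (norm (f z))\<^sup>2))
          + norm z * (norm (z * deriv f z - f z))\<^sup>2 / ((norm z)\<^sup>2 - (norm (f z))\<^sup>2)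
         \<le> norm z * ((norm z)\<^sup>2 - (norm (f z))\<^sup>2) / (1 - (norm z)\<^sup>2)\<^sup>2"
proof -
  obtain g where g: "g holomorphic_on ball 0 1" "\<And>w. w \<in> ball 0 1 \<Longrightarrow> f w = w * g w"
      "\<And>w. w \<in> ball 0 1 \<Longrightarrow> norm (g w) \<le> 1"
    by (rule Schwarz_quotient[OF assms(1,2,4)]) auto
  have g1: "norm (g w) < 1" if "w \<in> ball 0 1" for w
    using bounded_by_1_strict_or_constant[OF g(1,3)] that
      rotation_conformal_automorphism[of _ f] assms(3) g(2) by (metis mult.commute)
  have z: "z \<in> ball 0 1" "z \<noteq> 0"
    using assms(5) by auto
  have dg: "(g has_field_derivative deriv g w) (at w)"
    "(deriv g has_field_derivative deriv (deriv g) w) (at w)" if "w \<in> ball 0 1" for w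
    using g(1) holomorphic_deriv[OF g(1)] that by (auto intro!: holomorphic_derivI)
  have f1: "deriv f w = g w + w * deriv g w" if w: "w \<in> ball 0 1" for w
  proof (rule DERIV_imp_deriv)
    have "((\<lambda>w. w * g w) has_field_derivative g w + w * deriv g w) (at w)"
      by (auto intro!: derivative_eq_intros dg[OF w])
    then show "(f has_field_derivative g w + w * deriv g w) (at w)"
      by (rule has_field_derivative_transform_within_open[OF _ open_ball w]) (simp add: g(2))
  qed
  have "((\<lambda>w. g w + w * deriv g w) has_field_derivative 2 * deriv g z + z * deriv (deriv g) z) (at z)"
    by (auto intro!: derivative_eq_intros dg[OF z(1)])
  then have "(deriv f has_field_derivative 2 * deriv g z + z * deriv (deriv g) z) (at z)"
    by (rule has_field_derivative_transform_within_open[OF _ open_ball z(1)]) (simp add: f1)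
  then have f2: "(deriv ^^ 2) f z = 2 * deriv g z + z * deriv (deriv g) z"
    by (simp add: DERIV_imp_deriv numeral_2_eq_2)
  define r R A where "r = norm z" and "R = 1 - (norm z)\<^sup>2" and "A = 1 - (norm (g z))\<^sup>2"
  have pos: "r > 0" "R > 0" "A > 0"
    unfolding r_def R_def A_def using z g1 by (auto simp: power_less_one_iff)
  have D: "z * deriv f z - f z = z\<^sup>2 * deriv g z"
    using g(2)[OF z(1)] f1[OF z(1)] by (simp add: algebra_simps power2_eq_square)
  have Q: "r\<^sup>2 - (norm (f z))\<^sup>2 = r\<^sup>2 * A"
    using g(2)[OF z(1)] by (simp add: A_def r_def norm_mult power_mult_distrib algebra_simps)
  have zz: "complex_of_real (r\<^sup>2) = z * cnj z" and RR: "complex_of_real R = 1 - z * cnj z"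
    unfolding r_def R_def by (simp_all add: complex_norm_square del: of_real_power)
  define E where "E = deriv (deriv g) z / 2 - cnj z * deriv g z / R + cnj (g z) * (deriv g z)\<^sup>2 / A"
  have nz: "complex_of_real R \<noteq> 0" "complex_of_real A \<noteq> 0" "cnj z \<noteq> 0"
    using pos z by auto
  \<comment> \<open>The term \<open>z\<^sup>2 * g'\<close> coming from \<open>f''\<close> combines with \<open>- z\<^sup>2 * g' / R\<close> because \<open>1 - 1 / R = - z * cnj z / R\<close>.\<close>
  have "z\<^sup>2 * deriv g z - z\<^sup>2 * deriv g z / R = - (z ^ 3 * (cnj z * deriv g z / R))"
    using nz(1) by (simp add: field_simps) (simp add: RR algebra_simps power2_eq_square power3_eq_cube)
  moreover have "cnj (f z) * (z\<^sup>2 * deriv g z)\<^sup>2 / of_real (r\<^sup>2 * A)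
      = z ^ 3 * (cnj (g z) * (deriv g z)\<^sup>2 / A)"
    using nz(2,3) z(2) g(2)[OF z(1)] unfolding of_real_mult zz
    by (simp add: field_simps power2_eq_square power3_eq_cube)
  ultimately have "1 / 2 * z\<^sup>2 * (deriv ^^ 2) f z - z\<^sup>2 * deriv g z / R
      + cnj (f z) * (z\<^sup>2 * deriv g z)\<^sup>2 / of_real (r\<^sup>2 * A) = z ^ 3 * E"
    unfolding f2 E_def by (simp add: algebra_simps power2_eq_square power3_eq_cube)
  then have "norm (1 / 2 * z\<^sup>2 * (deriv ^^ 2) f z - z\<^sup>2 * deriv g z / R
        + cnj (f z) * (z\<^sup>2 * deriv g z)\<^sup>2 / of_real (r\<^sup>2 * A))
      + r * (norm (z\<^sup>2 * deriv g z))\<^sup>2 / (r\<^sup>2 * A)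
      = r ^ 3 * (norm E + (norm (deriv g z))\<^sup>2 / A)"
    using pos by (simp add: norm_mult norm_power r_def[symmetric] field_simps eval_nat_numeral)
  also have "\<dots> \<le> r ^ 3 * (A / R\<^sup>2)"
    using second_order_Schwarz_Pick[OF g(1) g1 z(1)] pos
    unfolding E_def R_def A_def by (intro mult_left_mono) auto
  also have "\<dots> = r * (r\<^sup>2 * A) / R\<^sup>2"
    by (simp add: power2_eq_square power3_eq_cube)
  finally show ?thesis
    unfolding D r_def[symmetric] Q R_def .
qed

end
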